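(* Let $n,p,\tilde n,\tilde p$ be real numbers with $0<p<n/2$ and $0<\tilde p<\tilde n/2$. If $(p,n)\neq(\tilde p,\tilde n)$, then $W_{p,n}$ is not similar to $W_{\tilde p,\tilde n}$.
   Context: For real $0<p<n/2$, $$W_{p,n}(x)=(1-x^2)^{\frac n2-1}\begin{pmatrix} p\,x^2+n-p & -nx\\ -nx & (n-p)x^2+p\end{pmatrix},\quad x\in[-1,1].$$ Two matrix weights $W$ and $\widetilde W$ on an interval $(a,b)$ are similar if there exists a nonsingular complex matrix $M$, independent of $x$, such that $\widetilde W(x)=MW(x)M^*$ for all $x\in(a,b)$, where $M^*$ is the conjugate transpose. Here $(a,b)=(-1,1)$. *)

theory Defs
  imports "HOL-Analysis.Analysis"
begin

definition conj_transpose :: "complex^'m^'n \<Rightarrow> complex^'n^'m" where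
  "conj_transpose A = map_matrix cnj (transpose A)"

definition similar_weights ::
    "real \<Rightarrow> real \<Rightarrow> (real \<Rightarrow> complex^'n^'n) \<Rightarrow> (real \<Rightarrow> complex^'n^'n) \<Rightarrow> bool" where
  "similar_weights a b W W' \<longleftrightarrow>
     (\<exists>M :: complex^'n^'n. invertible M \<and>
        (\<forall>x\<in>{a<..<b}. W' x = M ** W x ** conj_transpose M))"

(* The weight has real entries; it takes values in complex matrices because the similarity
   matrix M is complex. At the endpoints the library's value 0 powr a = 0 is used, but
   similarity only looks at the open interval, where 1 - x^2 > 0. *)
definition weight_W :: "real \<Rightarrow> real \<Rightarrow> real \<Rightarrow> complex^2^2" where
  "weight_W p n x = map_matrix complex_of_real
     ((1 - x\<^sup>2) powr (n / 2 - 1) *\<^sub>R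
       vector [vector [p * x\<^sup>2 + n - p, - n * x],
               vector [- n * x, (n - p) * x\<^sup>2 + p]])"

end

(* Similarity multiplies the determinant of every linear combination of values of a weight by
   |det M|^2.  Since det (W_{p,n} x) = p (n - p) (1 - x^2)^n, comparing determinants at 0 and at
   1/2 gives n = n'.  The odd part of the weight does not involve p, so its determinant then forces
   |det M| = 1, whence p (n - p) = p' (n - p'); as p and p' are both below n/2, they agree. *)
theory Submission
  imports Defs
begin

lemma det_conj_transpose:
  fixes A :: "complex^'n^'n"
  shows "det (conj_transpose A) = cnj (det A)"
proof -
  have "det (map_matrix cnj B) = cnj (det B)" for B :: "complex^'n^'n"
    by (simp add: det_def map_matrix_def cnj_sum)
  then show ?thesis
    by (simp add: conj_transpose_def det_transpose)
qed

lemma det_conj_congruence: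
  fixes M A :: "complex^'n^'n"
  shows "det (M ** A ** conj_transpose M) = complex_of_real ((cmod (det M))\<^sup>2) * det A"
proof -
  have "det (M ** A ** conj_transpose M) = det M * cnj (det M) * det A"
    by (simp add: det_mul det_conj_transpose)
  then show ?thesis
    by (simp only: complex_norm_square)
qed

lemma matrix_mult_diff_congruence:
  fixes M A B N :: "'a::ring_1^'n^'n"
  shows "M ** (A - B) ** N = M ** A ** N - M ** B ** N"
  by (simp add: matrix_matrix_mult_def vec_eq_iff left_diff_distrib right_diff_distrib
      sum_subtractf)

text \<open>As p^2 + (n - p)^2 - n^2 = -2 p (n - p), the polynomial factor has determinant p (n - p)
  (1 - x^2)^2. The squared scalar factor contributes the remaining exponent n - 2.\<close>

lemma det_weight_W:
  assumes "\<bar>x\<bar> < 1"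
  shows "det (weight_W p n x) = complex_of_real (p * (n - p) * (1 - x\<^sup>2) powr n)"
proof -
  define s where "s = (1 - x\<^sup>2) powr (n / 2 - 1)"
  have pos: "1 - x\<^sup>2 > 0"
    using assms by (simp add: abs_square_less_1)
  have "s\<^sup>2 * (1 - x\<^sup>2)\<^sup>2 = (1 - x\<^sup>2) powr n"
  proof -
    have "s * (1 - x\<^sup>2) = (1 - x\<^sup>2) powr (n / 2)"
      using pos by (simp add: s_def powr_diff)
    then have "(s * (1 - x\<^sup>2))\<^sup>2 = (1 - x\<^sup>2) powr (n / 2) * (1 - x\<^sup>2) powr (n / 2)"
      by (simp only: power2_eq_square)
    also have "\<dots> = (1 - x\<^sup>2) powr n"
      by (simp only: powr_add[symmetric]) simp
    finally show ?thesis
      by (simp only: power_mult_distrib)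
  qed
  moreover have "det (weight_W p n x)
      = complex_of_real (s * (p * x\<^sup>2 + n - p) * (s * ((n - p) * x\<^sup>2 + p)) - (s * (n * x))\<^sup>2)"
    by (simp add: det_2 weight_W_def map_matrix_def s_def power2_eq_square)
  moreover have "s * (p * x\<^sup>2 + n - p) * (s * ((n - p) * x\<^sup>2 + p)) - (s * (n * x))\<^sup>2
      = p * (n - p) * (s\<^sup>2 * (1 - x\<^sup>2)\<^sup>2)"
    by algebra
  ultimately show ?thesis
    by simp
qed

text \<open>The diagonal entries are even in x and cancel, while the off-diagonal ones are odd and
  double. What is left is antidiagonal with two equal entries.\<close>

lemma det_weight_W_odd_part:
  "det (weight_W p n x - weight_W p n (- x))
    = complex_of_real (- ((1 - x\<^sup>2) powr (n / 2 - 1) * (2 * n * x))\<^sup>2)"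
  by (simp add: det_2 weight_W_def map_matrix_def power2_eq_square algebra_simps)

theorem lemma3p1:
  fixes n p n' p' :: real
  assumes "0 < p" and "p < n / 2"
    and "0 < p'" and "p' < n' / 2"
    and "(p, n) \<noteq> (p', n')"
  shows "\<not> similar_weights (-1) 1 (weight_W p n) (weight_W p' n')"
proof
  assume "similar_weights (-1) 1 (weight_W p n) (weight_W p' n')"
  then obtain M where
    M: "\<And>x. \<bar>x\<bar> < 1 \<Longrightarrow> weight_W p' n' x = M ** weight_W p n x ** conj_transpose M"
    by (auto simp: similar_weights_def abs_less_iff)
  define c where "c = (cmod (det M))\<^sup>2"
  have det_scale: "p' * (n' - p') * (1 - x\<^sup>2) powr n' = c * (p * (n - p) * (1 - x\<^sup>2) powr n)"
    if "\<bar>x\<bar> < 1" for x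
    using arg_cong[OF M[OF that], of det]
    unfolding det_conj_congruence det_weight_W[OF that] c_def of_real_mult[symmetric] of_real_eq_iff .
  have scale: "p' * (n' - p') = c * (p * (n - p))"
    using det_scale[of 0] by simp
  moreover have "p' * (n' - p') > 0"
    using assms by simp
  \<comment> \<open>By \<open>scale\<close> both sides at 1/2 carry the same coefficient; being
    positive, it cancels.\<close>
  ultimately have "(3/4 :: real) powr n' = (3/4) powr n"
    using det_scale[of "1/2"] by (auto simp: power2_eq_square)
  \<comment> \<open>The exponents can be compared because ln (3/4) is nonzero.\<close>
  then have n: "n' = n"
    by (simp add: powr_def)
  have "weight_W p' n' (1/2) - weight_W p' n' (- (1/2))
      = M ** (weight_W p n (1/2) - weight_W p n (- (1/2))) ** conj_transpose M"
    using M[of "1/2"] M[of "- (1/2)"]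
    by (simp add: matrix_mult_diff_congruence)
  \<comment> \<open>With n' = n the two odd parts have the same determinant, nonzero because n > 0,
    so the factor \<open>c\<close> must be 1.\<close>
  from arg_cong[OF this, of det] have "((3/4) powr (n / 2 - 1) * n)\<^sup>2 = c * ((3/4) powr (n / 2 - 1) * n)\<^sup>2"
    unfolding det_conj_congruence det_weight_W_odd_part of_real_mult[symmetric] of_real_eq_iff n c_def[symmetric]
    by (simp add: power2_eq_square)
  moreover have "n > 0"
    using assms by simp
  ultimately have "c = 1"
    by simp
  \<comment> \<open>The product is p (n - p) - p' (n - p'). Its second factor is positive, as p and
    p' lie below n/2.\<close>
  with scale n have "(p - p') * (n - p - p') = 0"
    by algebra
  then show False
    using assms n by auto
qed

end
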